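(* For every natural number $k$ and every formula $\varphi$: (1) if $\varphi \in \mathrm{E}_k^+$, then $\mathrm{PNF}(\varphi) \cap \Sigma_k^+ \neq \emptyset$; (2) if $\varphi \in \mathrm{U}_k^+$, then $\mathrm{PNF}(\varphi) \cap \Pi_k^+ \neq \emptyset$.
   Context: Fix an arbitrary first-order language whose logical symbols are $\forall, \exists, \to, \land, \lor, \perp$. $\mathrm{FV}(\varphi)$ is the set of free variables of $\varphi$. Prenex classes: $\Sigma_0 = \Pi_0$ is the class of quantifier-free formulas; $\Sigma_{k+1}$ is the class of formulas $\exists x_1 \cdots \exists x_n \varphi$ with $n \geq 1$ and $\varphi \in \Pi_k$; $\Pi_{k+1}$ is the class of formulas $\forall x_1 \cdots \forall x_n \varphi$ with $n\ge 1$ and $\varphi \in \Sigma_k$. $\Sigma_k^+ = \Sigma_k \cup \bigcup_{i<k}(\Sigma_i \cup \Pi_i)$, $\Pi_k^+ = \Pi_k \cup \bigcup_{i<k}(\Sigma_i \cup \Pi_i)$. A formula is in prenex normal form if it is in $\Sigma_k \cup \Pi_k$ for some $k$. Alternation paths: finite sequences of $+$ and $-$ in which $+$ and $-$ alternate. For such $s$, $i(s)$ is its first symbol if $s$ is nonempty and a special symbol $\times$ if $s=\langle\,\rangle$; $s^\perp$ swaps $+$ and $-$; $l(s)$ is its length; $+s$, $-s$ denote prepending. $\mathrm{Alt}(\varphi)$: if $\varphi$ is quantifier-free, $\{\langle\,\rangle\}$; otherwise $\mathrm{Alt}(\varphi_1 \land \varphi_2)=\mathrm{Alt}(\varphi_1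 \lor \varphi_2) = \mathrm{Alt}(\varphi_1)\cup\mathrm{Alt}(\varphi_2)$; $\mathrm{Alt}(\varphi_1\to\varphi_2) = \{s^\perp : s\in\mathrm{Alt}(\varphi_1)\}\cup\mathrm{Alt}(\varphi_2)$; $\mathrm{Alt}(\forall x\varphi_1) = \{s\in\mathrm{Alt}(\varphi_1): i(s)=-\}\cup\{-s: s\in\mathrm{Alt}(\varphi_1), i(s)\neq -\}$; $\mathrm{Alt}(\exists x\varphi_1) = \{s\in\mathrm{Alt}(\varphi_1): i(s)=+\}\cup\{+s: s\in\mathrm{Alt}(\varphi_1), i(s)\neq +\}$. $\deg(\varphi)=\max\{l(s): s\in\mathrm{Alt}(\varphi)\}$. Classes: $\mathrm{F}_k=\{\varphi:\deg(\varphi)=k\}$; $\mathrm{U}_0=\mathrm{E}_0=\mathrm{F}_0$; $\mathrm{U}_{k+1}=\{\varphi\in\mathrm{F}_{k+1}: i(s)=- \text{ for all } s\in\mathrm{Alt}(\varphi) \text{ with } l(s)=k+1\}$; $\mathrm{E}_{k+1}$ likewise with $+$; $\mathrm{U}_k^+=\mathrm{U}_k\cup\bigcup_{i<k}\mathrm{F}_i$; $\mathrm{E}_k^+=\mathrm{E}_k\cup\bigcup_{i<k}\mathrm{F}_i$. Prenex transformation: $\varphi\rhd\psi$ means that for some formulas $\xi,\delta$, a variable $x\notin\mathrm{FV}(\delta)$, a variable $y$ not occurring in $\xi$, and $Q\in\{\forall,\exists\}$, $(\varphi,\psi)$ is one of: $(\exists x\xi(x)\to\delta, \forall x(\xi(x)\to\delta))$;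 $(\forall x\xi(x)\to\delta, \exists x(\xi(x)\to\delta))$; $(\delta\to Qx\,\xi(x), Qx(\delta\to\xi(x)))$; $(Qx\,\xi(x)\land\delta, Qx(\xi(x)\land\delta))$; $(\delta\land Qx\,\xi(x), Qx(\delta\land\xi(x)))$; $(Qx\,\xi(x)\lor\delta, Qx(\xi(x)\lor\delta))$; $(\delta\lor Qx\,\xi(x), Qx(\delta\lor\xi(x)))$; $(Qx\,\xi(x), Qy\,\xi(y))$, with $\xi(y)$ the substitution of $y$ for free $x$. $\varphi\rhd^*\psi$ means there are $m\ge0$ and $\varphi_0\equiv\varphi,\dots,\varphi_m\equiv\psi$ with each $\varphi_{i+1}$ obtained from $\varphi_i$ by replacing one occurrence of a subformula $\xi_i$ with $\delta_i$ where $\xi_i\rhd\delta_i$. $\mathrm{PNF}(\varphi)=\{\psi:\varphi\rhd^*\psi \text{ and } \psi \text{ is in prenex normal form}\}$. *)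

theory Defs
  imports Main
begin

datatype 'f trm = Var nat | Fn 'f "'f trm list"

datatype ('f, 'p) fm =
    Bot
  | Pred 'p "'f trm list"
  | Imp "('f, 'p) fm" "('f, 'p) fm"
  | Conj "('f, 'p) fm" "('f, 'p) fm"
  | Disj "('f, 'p) fm" "('f, 'p) fm"
  | Forall nat "('f, 'p) fm"
  | Exists nat "('f, 'p) fm"

text \<open>A language is given by its sets of function and predicate symbols, each symbol paired
  with its arity (constants have arity 0; equality, if present, is a binary predicate symbol).
  The sets may be empty, so languages without function symbols are included.\<close>

datatype ('f, 'p) language = Language (funs: "('f \<times> nat) set") (preds: "('p \<times> nat) set")

fun term_of_lang :: "('f, 'p) language \<Rightarrow> 'f trm \<Rightarrow> bool" where
  "term_of_lang L (Var x) \<longleftrightarrow> True"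
| "term_of_lang L (Fn f ts) \<longleftrightarrow> (f, length ts) \<in> funs L \<and> (\<forall>t \<in> set ts. term_of_lang L t)"

fun fm_of_lang :: "('f, 'p) language \<Rightarrow> ('f, 'p) fm \<Rightarrow> bool" where
  "fm_of_lang L Bot \<longleftrightarrow> True"
| "fm_of_lang L (Pred p ts) \<longleftrightarrow> (p, length ts) \<in> preds L \<and> (\<forall>t \<in> set ts. term_of_lang L t)"
| "fm_of_lang L (Imp \<phi> \<psi>) \<longleftrightarrow> fm_of_lang L \<phi> \<and> fm_of_lang L \<psi>"
| "fm_of_lang L (Conj \<phi> \<psi>) \<longleftrightarrow> fm_of_lang L \<phi> \<and> fm_of_lang L \<psi>"
| "fm_of_lang L (Disj \<phi> \<psi>) \<longleftrightarrow> fm_of_lang L \<phi> \<and> fm_of_lang L \<psi>"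
| "fm_of_lang L (Forall x \<phi>) \<longleftrightarrow> fm_of_lang L \<phi>"
| "fm_of_lang L (Exists x \<phi>) \<longleftrightarrow> fm_of_lang L \<phi>"

definition formulas :: "('f, 'p) language \<Rightarrow> ('f, 'p) fm set" where
  "formulas L = {\<phi>. fm_of_lang L \<phi>}"

fun vars_trm :: "'f trm \<Rightarrow> nat set" where
  "vars_trm (Var x) = {x}"
| "vars_trm (Fn f ts) = (\<Union>t \<in> set ts. vars_trm t)"

fun FV :: "('f, 'p) fm \<Rightarrow> nat set" where
  "FV Bot = {}"
| "FV (Pred p ts) = (\<Union>t \<in> set ts. vars_trm t)"
| "FV (Imp \<phi> \<psi>) = FV \<phi> \<union> FV \<psi>"
| "FV (Conj \<phi> \<psi>) = FV \<phi> \<union> FV \<psi>"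
| "FV (Disj \<phi> \<psi>) = FV \<phi> \<union> FV \<psi>"
| "FV (Forall x \<phi>) = FV \<phi> - {x}"
| "FV (Exists x \<phi>) = FV \<phi> - {x}"

text \<open>All variables occurring in a formula: free, bound, or only next to a quantifier.\<close>

fun vars_fm :: "('f, 'p) fm \<Rightarrow> nat set" where
  "vars_fm Bot = {}"
| "vars_fm (Pred p ts) = (\<Union>t \<in> set ts. vars_trm t)"
| "vars_fm (Imp \<phi> \<psi>) = vars_fm \<phi> \<union> vars_fm \<psi>"
| "vars_fm (Conj \<phi> \<psi>) = vars_fm \<phi> \<union> vars_fm \<psi>"
| "vars_fm (Disj \<phi> \<psi>) = vars_fm \<phi> \<union> vars_fm \<psi>"
| "vars_fm (Forall x \<phi>) = insert x (vars_fm \<phi>)"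
| "vars_fm (Exists x \<phi>) = insert x (vars_fm \<phi>)"

fun subst_trm :: "nat \<Rightarrow> nat \<Rightarrow> 'f trm \<Rightarrow> 'f trm" where
  "subst_trm x y (Var z) = Var (if z = x then y else z)"
| "subst_trm x y (Fn f ts) = Fn f (map (subst_trm x y) ts)"

text \<open>\<open>subst_fm x y \<phi>\<close> replaces the free occurrences of \<open>x\<close> by \<open>y\<close>. Bound variables are not
  renamed; it is only used for \<open>y\<close> not occurring in \<open>\<phi>\<close>, so no capture can arise.\<close>

fun subst_fm :: "nat \<Rightarrow> nat \<Rightarrow> ('f, 'p) fm \<Rightarrow> ('f, 'p) fm" where
  "subst_fm x y Bot = Bot"
| "subst_fm x y (Pred p ts) = Pred p (map (subst_trm x y) ts)"
| "subst_fm x y (Imp \<phi> \<psi>) = Imp (subst_fm x y \<phi>) (subst_fm x y \<psi>)"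
| "subst_fm x y (Conj \<phi> \<psi>) = Conj (subst_fm x y \<phi>) (subst_fm x y \<psi>)"
| "subst_fm x y (Disj \<phi> \<psi>) = Disj (subst_fm x y \<phi>) (subst_fm x y \<psi>)"
| "subst_fm x y (Forall z \<phi>) = Forall z (if z = x then \<phi> else subst_fm x y \<phi>)"
| "subst_fm x y (Exists z \<phi>) = Exists z (if z = x then \<phi> else subst_fm x y \<phi>)"

fun qfree :: "('f, 'p) fm \<Rightarrow> bool" where
  "qfree Bot \<longleftrightarrow> True"
| "qfree (Pred p ts) \<longleftrightarrow> True"
| "qfree (Imp \<phi> \<psi>) \<longleftrightarrow> qfree \<phi> \<and> qfree \<psi>"
| "qfree (Conj \<phi> \<psi>) \<longleftrightarrow> qfree \<phi> \<and> qfree \<psi>"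
| "qfree (Disj \<phi> \<psi>) \<longleftrightarrow> qfree \<phi> \<and> qfree \<psi>"
| "qfree (Forall x \<phi>) \<longleftrightarrow> False"
| "qfree (Exists x \<phi>) \<longleftrightarrow> False"

fun Sigma_fm :: "nat \<Rightarrow> ('f, 'p) fm set" and Pi_fm :: "nat \<Rightarrow> ('f, 'p) fm set" where
  "Sigma_fm 0 = {\<phi>. qfree \<phi>}"
| "Sigma_fm (Suc k) = {foldr Exists xs \<phi> | xs \<phi>. xs \<noteq> [] \<and> \<phi> \<in> Pi_fm k}"
| "Pi_fm 0 = {\<phi>. qfree \<phi>}"
| "Pi_fm (Suc k) = {foldr Forall xs \<phi> | xs \<phi>. xs \<noteq> [] \<and> \<phi> \<in> Sigma_fm k}"

definition Sigma_plus :: "nat \<Rightarrow> ('f, 'p) fm set" where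
  "Sigma_plus k = Sigma_fm k \<union> (\<Union>i<k. Sigma_fm i \<union> Pi_fm i)"

definition Pi_plus :: "nat \<Rightarrow> ('f, 'p) fm set" where
  "Pi_plus k = Pi_fm k \<union> (\<Union>i<k. Sigma_fm i \<union> Pi_fm i)"

definition prenex :: "('f, 'p) fm \<Rightarrow> bool" where
  "prenex \<phi> \<longleftrightarrow> (\<exists>k. \<phi> \<in> Sigma_fm k \<union> Pi_fm k)"

datatype sign = Plus | Minus

text \<open>The initial symbol of a path; \<open>None\<close> plays the role of the special symbol for the
  empty path.\<close>

fun init_sign :: "sign list \<Rightarrow> sign option" where
  "init_sign [] = None"
| "init_sign (a # s) = Some a"

fun swap_sign :: "sign \<Rightarrow> sign" where
  "swap_sign Plus = Minus"
| "swap_sign Minus = Plus"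

fun Alt :: "('f, 'p) fm \<Rightarrow> sign list set" where
  "Alt Bot = {[]}"
| "Alt (Pred p ts) = {[]}"
| "Alt (Imp \<phi> \<psi>) = (if qfree (Imp \<phi> \<psi>) then {[]} else map swap_sign ` Alt \<phi> \<union> Alt \<psi>)"
| "Alt (Conj \<phi> \<psi>) = (if qfree (Conj \<phi> \<psi>) then {[]} else Alt \<phi> \<union> Alt \<psi>)"
| "Alt (Disj \<phi> \<psi>) = (if qfree (Disj \<phi> \<psi>) then {[]} else Alt \<phi> \<union> Alt \<psi>)"
| "Alt (Forall x \<phi>) = {s \<in> Alt \<phi>. init_sign s = Some Minus}
     \<union> {Minus # s | s. s \<in> Alt \<phi> \<and> init_sign s \<noteq> Some Minus}"
| "Alt (Exists x \<phi>) = {s \<in> Alt \<phi>. init_sign s = Some Plus}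
     \<union> {Plus # s | s. s \<in> Alt \<phi> \<and> init_sign s \<noteq> Some Plus}"

lemma finite_Alt: "finite (Alt \<phi>)"
  by (induction \<phi>) (auto simp: setcompr_eq_image)

lemma Alt_nonempty: "Alt \<phi> \<noteq> {}"
  by (induction \<phi>) auto

lemma Alt_alternating: "s \<in> Alt \<phi> \<Longrightarrow> successively (\<noteq>) s"
proof (induction \<phi> arbitrary: s)
  case (Imp \<phi> \<psi>)
  have "swap_sign a = swap_sign b \<longleftrightarrow> a = b" for a b
    by (cases a; cases b) auto
  with Imp show ?case by (auto simp: successively_map split: if_splits)
next
  case (Forall x \<phi>)
  have "successively (\<noteq>) (Minus # s)" if "successively (\<noteq>) s" "init_sign s \<noteq> Some Minus" for s
    using that by (cases s) auto
  with Forall show ?case by auto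
next
  case (Exists x \<phi>)
  have "successively (\<noteq>) (Plus # s)" if "successively (\<noteq>) s" "init_sign s \<noteq> Some Plus" for s
    using that by (cases s) auto
  with Exists show ?case by auto
qed (auto split: if_splits)

definition deg :: "('f, 'p) fm \<Rightarrow> nat" where
  "deg \<phi> = Max (length ` Alt \<phi>)"

definition F_class :: "nat \<Rightarrow> ('f, 'p) fm set" where
  "F_class k = {\<phi>. deg \<phi> = k}"

fun U_class :: "nat \<Rightarrow> ('f, 'p) fm set" where
  "U_class 0 = F_class 0"
| "U_class (Suc k) = {\<phi> \<in> F_class (Suc k).
     \<forall>s \<in> Alt \<phi>. length s = Suc k \<longrightarrow> init_sign s = Some Minus}"

fun E_class :: "nat \<Rightarrow> ('f, 'p) fm set" where
  "E_class 0 = F_class 0"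
| "E_class (Suc k) = {\<phi> \<in> F_class (Suc k).
     \<forall>s \<in> Alt \<phi>. length s = Suc k \<longrightarrow> init_sign s = Some Plus}"

definition U_plus :: "nat \<Rightarrow> ('f, 'p) fm set" where
  "U_plus k = U_class k \<union> (\<Union>i<k. F_class i)"

definition E_plus :: "nat \<Rightarrow> ('f, 'p) fm set" where
  "E_plus k = E_class k \<union> (\<Union>i<k. F_class i)"

inductive prenex_rule :: "('f, 'p) fm \<Rightarrow> ('f, 'p) fm \<Rightarrow> bool"  (infix "\<rhd>" 50) where
  Exists_Imp: "x \<notin> FV \<delta> \<Longrightarrow> Imp (Exists x \<xi>) \<delta> \<rhd> Forall x (Imp \<xi> \<delta>)"
| Forall_Imp: "x \<notin> FV \<delta> \<Longrightarrow> Imp (Forall x \<xi>) \<delta> \<rhd> Exists x (Imp \<xi> \<delta>)"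
| Imp_Q: "Q \<in> {Forall, Exists} \<Longrightarrow> x \<notin> FV \<delta> \<Longrightarrow> Imp \<delta> (Q x \<xi>) \<rhd> Q x (Imp \<delta> \<xi>)"
| Q_Conj: "Q \<in> {Forall, Exists} \<Longrightarrow> x \<notin> FV \<delta> \<Longrightarrow> Conj (Q x \<xi>) \<delta> \<rhd> Q x (Conj \<xi> \<delta>)"
| Conj_Q: "Q \<in> {Forall, Exists} \<Longrightarrow> x \<notin> FV \<delta> \<Longrightarrow> Conj \<delta> (Q x \<xi>) \<rhd> Q x (Conj \<delta> \<xi>)"
| Q_Disj: "Q \<in> {Forall, Exists} \<Longrightarrow> x \<notin> FV \<delta> \<Longrightarrow> Disj (Q x \<xi>) \<delta> \<rhd> Q x (Disj \<xi> \<delta>)"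
| Disj_Q: "Q \<in> {Forall, Exists} \<Longrightarrow> x \<notin> FV \<delta> \<Longrightarrow> Disj \<delta> (Q x \<xi>) \<rhd> Q x (Disj \<delta> \<xi>)"
| Rename: "Q \<in> {Forall, Exists} \<Longrightarrow> y \<notin> vars_fm \<xi> \<Longrightarrow> Q x \<xi> \<rhd> Q y (subst_fm x y \<xi>)"

text \<open>Replacement of exactly one subformula occurrence by the rule.\<close>

inductive prenex_step :: "('f, 'p) fm \<Rightarrow> ('f, 'p) fm \<Rightarrow> bool" where
  here: "\<xi> \<rhd> \<delta> \<Longrightarrow> prenex_step \<xi> \<delta>"
| Imp_left: "prenex_step \<phi> \<phi>' \<Longrightarrow> prenex_step (Imp \<phi> \<psi>) (Imp \<phi>' \<psi>)"
| Imp_right: "prenex_step \<psi> \<psi>' \<Longrightarrow> prenex_step (Imp \<phi> \<psi>) (Imp \<phi> \<psi>')"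
| Conj_left: "prenex_step \<phi> \<phi>' \<Longrightarrow> prenex_step (Conj \<phi> \<psi>) (Conj \<phi>' \<psi>)"
| Conj_right: "prenex_step \<psi> \<psi>' \<Longrightarrow> prenex_step (Conj \<phi> \<psi>) (Conj \<phi> \<psi>')"
| Disj_left: "prenex_step \<phi> \<phi>' \<Longrightarrow> prenex_step (Disj \<phi> \<psi>) (Disj \<phi>' \<psi>)"
| Disj_right: "prenex_step \<psi> \<psi>' \<Longrightarrow> prenex_step (Disj \<phi> \<psi>) (Disj \<phi> \<psi>')"
| Forall_body: "prenex_step \<phi> \<phi>' \<Longrightarrow> prenex_step (Forall x \<phi>) (Forall x \<phi>')"
| Exists_body: "prenex_step \<phi> \<phi>' \<Longrightarrow> prenex_step (Exists x \<phi>) (Exists x \<phi>')"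

abbreviation prenex_steps :: "('f, 'p) fm \<Rightarrow> ('f, 'p) fm \<Rightarrow> bool"  (infix "\<rhd>\<^sup>*" 50) where
  "\<phi> \<rhd>\<^sup>* \<psi> \<equiv> prenex_step\<^sup>*\<^sup>* \<phi> \<psi>"

definition PNF :: "('f, 'p) language \<Rightarrow> ('f, 'p) fm \<Rightarrow> ('f, 'p) fm set" where
  "PNF L \<phi> = {\<psi> \<in> formulas L. \<phi> \<rhd>\<^sup>* \<psi> \<and> prenex \<psi>}"

lemma term_of_lang_subst: "term_of_lang L t \<Longrightarrow> term_of_lang L (subst_trm x y t)"
  by (induction t) auto

lemma fm_of_lang_subst: "fm_of_lang L \<phi> \<Longrightarrow> fm_of_lang L (subst_fm x y \<phi>)"
  by (induction \<phi>) (auto simp: term_of_lang_subst)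

lemma fm_of_lang_rule: "\<phi> \<rhd> \<psi> \<Longrightarrow> fm_of_lang L \<phi> \<Longrightarrow> fm_of_lang L \<psi>"
  by (induction rule: prenex_rule.induct) (auto simp: fm_of_lang_subst)

lemma fm_of_lang_step: "prenex_step \<phi> \<psi> \<Longrightarrow> fm_of_lang L \<phi> \<Longrightarrow> fm_of_lang L \<psi>"
  by (induction rule: prenex_step.induct) (auto simp: fm_of_lang_rule)

text \<open>Transformations never leave the language, so the restriction to \<open>formulas L\<close> in \<open>PNF\<close>
  excludes nothing and the intermediate formulas need no separate restriction.\<close>

lemma formulas_prenex_steps: "\<phi> \<rhd>\<^sup>* \<psi> \<Longrightarrow> \<phi> \<in> formulas L \<Longrightarrow> \<psi> \<in> formulas L"
  unfolding formulas_def
  by (induction rule: rtranclp_induct) (auto simp: fm_of_lang_step)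

end

theory Submission imports Defs begin

text \<open>Replace the prenex classes by cumulative classes \<open>prenex_within b k\<close>, where \<open>b\<close> is the kind
  of the leading quantifier block and \<open>k\<close> bounds the number of blocks. The heart of the matter is
  that two formulas of the same class (of dual classes, for an implication) can be merged under a
  connective without leaving the cls: pull out all leading quantifiers of kind \<open>b\<close> from both
  sides first, after renaming them to fresh variables; what remains has at most \<open>k - 1\<close> blocks
  and the dual leading kind. The theorem follows by induction on the formula, since the
  alternation paths of a quantified formula force its degree bound to be positive and pass the
  bound on to the body.\<close>

section \<open>Cumulative prenex classes with a bounded number of quantifier blocks\<close>

fun quant :: "sign \<Rightarrow> nat \<Rightarrow> ('f, 'p) fm \<Rightarrow> ('f, 'p) fm" where
  "quant Plus = Exists"
| "quant Minus = Forall"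

lemma swap_sign_swap_sign [simp]: "swap_sign (swap_sign b) = b"
  by (cases b) auto

lemma quant_cases: "quant b \<in> {Forall, Exists}"
  by (cases b) auto

text \<open>The rule \<open>swap\<close> adds no quantifier, so a block may be empty and
  \<open>k\<close> is only an upper bound. Since \<open>quant\<close> demands a successor, level 0
  holds quantifier-free formulas only.\<close>

inductive prenex_within :: "sign \<Rightarrow> nat \<Rightarrow> ('f, 'p) fm \<Rightarrow> bool" where
  qfree: "qfree \<phi> \<Longrightarrow> prenex_within b k \<phi>"
| quant: "prenex_within b (Suc k) \<phi> \<Longrightarrow> prenex_within b (Suc k) (quant b x \<phi>)"
| swap: "prenex_within (swap_sign b) k \<phi> \<Longrightarrow> prenex_within b (Suc k) \<phi>"

lemma prenex_within_0: "prenex_within b 0 \<phi> \<longleftrightarrow> qfree \<phi>"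
  by (subst prenex_within.simps) auto

text \<open>Two cases suffice: a quantifier-free formula belongs to every class, so it also falls
  under \<open>swap\<close>.\<close>

lemma prenex_within_SucE:
  assumes "prenex_within b (Suc k) \<phi>"
  obtains (swap) "prenex_within (swap_sign b) k \<phi>"
  | (quant) x \<xi> where "\<phi> = quant b x \<xi>" "prenex_within b (Suc k) \<xi>"
  using assms by (cases rule: prenex_within.cases) (auto intro: prenex_within.qfree)

section \<open>Comparison with the classes \<open>Sigma_plus\<close> and
  \<open>Pi_plus\<close>\<close>

text \<open>The new quantifier either joins a leading existential block or opens one over a formula
  of \<open>Pi_fm j\<close>.\<close>

lemma Exists_Sigma_plus:
  assumes "\<phi> \<in> Sigma_plus (Suc k)"
  shows "Exists x \<phi> \<in> Sigma_plus (Suc k)"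
proof -
  have Sigma: "Exists x \<phi> \<in> Sigma_fm (Suc j)" if "\<phi> \<in> Sigma_fm (Suc j)" for j
  proof -
    from that obtain xs \<xi> where "\<phi> = foldr Exists xs \<xi>" "\<xi> \<in> Pi_fm j" by auto
    then have "Exists x \<phi> = foldr Exists (x # xs) \<xi>" "x # xs \<noteq> []" by auto
    with \<open>\<xi> \<in> Pi_fm j\<close> show ?thesis unfolding Sigma_fm.simps by blast
  qed
  have Pi: "Exists x \<phi> \<in> Sigma_fm (Suc j)" if "\<phi> \<in> Pi_fm j" for j
  proof -
    have "Exists x \<phi> = foldr Exists [x] \<phi>" "[x] \<noteq> []" by auto
    with that show ?thesis unfolding Sigma_fm.simps by blast
  qed
  from assms consider "\<phi> \<in> Sigma_fm (Suc k)"
    | j where "j \<le> k" "\<phi> \<in> Sigma_fm j" | j where "j \<le> k" "\<phi> \<in> Pi_fm j"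
    by (auto simp: Sigma_plus_def less_Suc_eq_le)
  then have "\<exists>j\<le>k. Exists x \<phi> \<in> Sigma_fm (Suc j)"
  proof cases
    case 1
    then show ?thesis using Sigma by blast
  next
    case (2 j)
    show ?thesis
    proof (cases j)
      case 0
      \<comment> \<open>Level 0 has no block to join, but there both hierarchies coincide, so a
        first block is opened.\<close>
      with 2 have "\<phi> \<in> Pi_fm 0" by simp
      then show ?thesis using Pi by blast
    next
      case (Suc i)
      with 2 show ?thesis using Sigma[of i] by (auto intro!: exI[of _ i] simp del: Sigma_fm.simps)
    qed
  next
    case (3 j)
    then show ?thesis using Pi by blast
  qed
  then obtain j where "j \<le> k" "Exists x \<phi> \<in> Sigma_fm (Suc j)" by blast
  then show ?thesis
    by (cases "j = k") (auto simp: Sigma_plus_def simp del: Sigma_fm.simps intro!: bexI[of _ "Suc j"])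
qed

text \<open>Dual of \<open>Exists_Sigma_plus\<close>, by the same choice between joining and opening
  a block.\<close>

lemma Forall_Pi_plus:
  assumes "\<phi> \<in> Pi_plus (Suc k)"
  shows "Forall x \<phi> \<in> Pi_plus (Suc k)"
proof -
  have Pi: "Forall x \<phi> \<in> Pi_fm (Suc j)" if "\<phi> \<in> Pi_fm (Suc j)" for j
  proof -
    from that obtain xs \<xi> where "\<phi> = foldr Forall xs \<xi>" "\<xi> \<in> Sigma_fm j" by auto
    then have "Forall x \<phi> = foldr Forall (x # xs) \<xi>" "x # xs \<noteq> []" by auto
    with \<open>\<xi> \<in> Sigma_fm j\<close> show ?thesis unfolding Pi_fm.simps by blast
  qed
  have Sigma: "Forall x \<phi> \<in> Pi_fm (Suc j)" if "\<phi> \<in> Sigma_fm j" for j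
  proof -
    have "Forall x \<phi> = foldr Forall [x] \<phi>" "[x] \<noteq> []" by auto
    with that show ?thesis unfolding Pi_fm.simps by blast
  qed
  from assms consider "\<phi> \<in> Pi_fm (Suc k)"
    | j where "j \<le> k" "\<phi> \<in> Pi_fm j" | j where "j \<le> k" "\<phi> \<in> Sigma_fm j"
    by (auto simp: Pi_plus_def less_Suc_eq_le)
  then have "\<exists>j\<le>k. Forall x \<phi> \<in> Pi_fm (Suc j)"
  proof cases
    case 1
    then show ?thesis using Pi by blast
  next
    case (2 j)
    show ?thesis
    proof (cases j)
      case 0
      with 2 have "\<phi> \<in> Sigma_fm 0" by simp
      then show ?thesis using Sigma by blast
    next
      case (Suc i)
      with 2 show ?thesis using Pi[of i] by (auto intro!: exI[of _ i] simp del: Pi_fm.simps)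
    qed
  next
    case (3 j)
    then show ?thesis using Sigma by blast
  qed
  then obtain j where "j \<le> k" "Forall x \<phi> \<in> Pi_fm (Suc j)" by blast
  then show ?thesis
    by (cases "j = k") (auto simp: Pi_plus_def simp del: Pi_fm.simps intro!: bexI[of _ "Suc j"])
qed

lemma qfree_Sigma_Pi_plus:
  assumes "qfree \<phi>"
  shows "\<phi> \<in> Sigma_plus k" "\<phi> \<in> Pi_plus k"
  using assms by (cases k; force simp: Sigma_plus_def Pi_plus_def)+

lemma Sigma_Pi_plus_Suc:
  "Sigma_plus k \<subseteq> Pi_plus (Suc k)" "Pi_plus k \<subseteq> Sigma_plus (Suc k)"
  by (auto simp: Sigma_plus_def Pi_plus_def less_Suc_eq)

lemma prenex_within_Sigma_Pi_plus:
  assumes "prenex_within b k \<phi>"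
  shows "\<phi> \<in> (case b of Plus \<Rightarrow> Sigma_plus k | Minus \<Rightarrow> Pi_plus k)"
  using assms
proof (induction rule: prenex_within.induct)
  case (qfree \<phi> b k)
  then show ?case by (auto simp: qfree_Sigma_Pi_plus split: sign.split)
next
  case (quant b k \<phi> x)
  show ?case using quant.IH by (cases b) (auto simp: Exists_Sigma_plus Forall_Pi_plus)
next
  case (swap b k \<phi>)
  show ?case using swap.IH Sigma_Pi_plus_Suc by (cases b) auto
qed

lemma Sigma_Pi_plus_prenex: "\<phi> \<in> Sigma_plus k \<union> Pi_plus k \<Longrightarrow> prenex \<phi>"
  by (auto simp: Sigma_plus_def Pi_plus_def prenex_def)

section \<open>Substitution, quantifier count and fresh variables\<close>

lemma qfree_subst_fm [simp]: "qfree (subst_fm x y \<phi>) \<longleftrightarrow> qfree \<phi>"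
  by (induction \<phi>) auto

lemma subst_fm_quant:
  "subst_fm x y (quant b z \<phi>) = quant b z (if z = x then \<phi> else subst_fm x y \<phi>)"
  by (cases b) auto

lemma prenex_within_subst_fm:
  "prenex_within b k \<phi> \<Longrightarrow> prenex_within b k (subst_fm x y \<phi>)"
proof (induction rule: prenex_within.induct)
  case (quant b k \<phi> z)
  then show ?case by (simp add: subst_fm_quant prenex_within.quant)
qed (auto intro: prenex_within.intros)

text \<open>Measure for the inner induction of \<open>merge\<close>. Renaming replaces a body by a
  substitution instance, which is not a subformula but has the same count.\<close>

fun quant_count :: "('f, 'p) fm \<Rightarrow> nat" where
  "quant_count Bot = 0"
| "quant_count (Pred p ts) = 0"
| "quant_count (Imp \<phi> \<psi>) = quant_count \<phi> + quant_count \<psi>"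
| "quant_count (Conj \<phi> \<psi>) = quant_count \<phi> + quant_count \<psi>"
| "quant_count (Disj \<phi> \<psi>) = quant_count \<phi> + quant_count \<psi>"
| "quant_count (Forall x \<phi>) = Suc (quant_count \<phi>)"
| "quant_count (Exists x \<phi>) = Suc (quant_count \<phi>)"

lemma quant_count_subst_fm [simp]: "quant_count (subst_fm x y \<phi>) = quant_count \<phi>"
  by (induction \<phi>) auto

lemma quant_count_quant [simp]: "quant_count (quant b x \<phi>) = Suc (quant_count \<phi>)"
  by (cases b) auto

lemma finite_vars_trm [simp]: "finite (vars_trm t)"
  by (induction t) auto

lemma finite_vars_fm [simp]: "finite (vars_fm \<phi>)"
  by (induction \<phi>) auto

lemma FV_subset_vars_fm: "FV \<phi> \<subseteq> vars_fm \<phi>"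
  by (induction \<phi>) auto

text \<open>Meets both side conditions at once: \<open>Rename\<close> needs \<open>y\<close> absent
  from the body, pulling out needs \<open>y\<close> not free in the other argument.\<close>

lemma fresh_variable:
  obtains y where "y \<notin> vars_fm \<phi>" "y \<notin> FV \<psi>"
proof -
  obtain y where "y \<notin> vars_fm \<phi> \<union> vars_fm \<psi>"
    using ex_new_if_finite[OF infinite_UNIV_nat, of "vars_fm \<phi> \<union> vars_fm \<psi>"] by auto
  then show thesis using FV_subset_vars_fm that by blast
qed

section \<open>Rewriting in contexts and merging under a connective\<close>

lemma prenex_steps_context:
  assumes "\<And>\<phi> \<phi>'. prenex_step \<phi> \<phi>' \<Longrightarrow> prenex_step (C \<phi>) (C \<phi>')"
    and "\<phi> \<rhd>\<^sup>* \<phi>'"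
  shows "C \<phi> \<rhd>\<^sup>* C \<phi>'"
  using assms(2) by (induction rule: rtranclp_induct) (auto intro: rtranclp.rtrancl_into_rtrancl assms(1))

lemma prenex_steps_quant: "\<phi> \<rhd>\<^sup>* \<phi>' \<Longrightarrow> quant b x \<phi> \<rhd>\<^sup>* quant b x \<phi>'"
  by (rule prenex_steps_context)
    (cases b; simp add: prenex_step.Forall_body prenex_step.Exists_body)

text \<open>\<open>conn\<close> stands for a connective; \<open>p\<close> tells how it transforms the kind of a quantifier that is
  pulled out of its left argument (\<open>swap_sign\<close> for implication, the identity otherwise).\<close>

locale pullable_connective =
  fixes conn :: "('f, 'p) fm \<Rightarrow> ('f, 'p) fm \<Rightarrow> ('f, 'p) fm" and p :: "sign \<Rightarrow> sign"
  assumes step_left: "prenex_step \<phi> \<phi>' \<Longrightarrow> prenex_step (conn \<phi> \<psi>) (conn \<phi>' \<psi>)"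
    and step_right: "prenex_step \<psi> \<psi>' \<Longrightarrow> prenex_step (conn \<phi> \<psi>) (conn \<phi> \<psi>')"
    and pull_left: "x \<notin> FV \<delta> \<Longrightarrow> conn (quant (p b) x \<xi>) \<delta> \<rhd> quant b x (conn \<xi> \<delta>)"
    and pull_right: "x \<notin> FV \<delta> \<Longrightarrow> conn \<delta> (quant b x \<xi>) \<rhd> quant b x (conn \<delta> \<xi>)"
    and qfree_conn: "qfree \<phi> \<Longrightarrow> qfree \<psi> \<Longrightarrow> qfree (conn \<phi> \<psi>)"
    and p_swap: "p (swap_sign b) = swap_sign (p b)"
begin

lemma steps_conn:
  assumes "\<phi> \<rhd>\<^sup>* \<phi>'" "\<psi> \<rhd>\<^sup>* \<psi>'"
  shows "conn \<phi> \<psi> \<rhd>\<^sup>* conn \<phi>' \<psi>'"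
proof -
  have "conn \<phi> \<psi> \<rhd>\<^sup>* conn \<phi>' \<psi>"
    using assms(1) by (rule prenex_steps_context[rotated]) (rule step_left)
  also have "conn \<phi>' \<psi> \<rhd>\<^sup>* conn \<phi>' \<psi>'"
    using assms(2) by (rule prenex_steps_context[rotated]) (rule step_right)
  finally show ?thesis .
qed

lemma rename_pull_left:
  assumes "y \<notin> vars_fm \<xi>" "y \<notin> FV \<delta>"
  shows "conn (quant (p b) x \<xi>) \<delta> \<rhd>\<^sup>* quant b y (conn (subst_fm x y \<xi>) \<delta>)"
proof -
  have "prenex_step (conn (quant (p b) x \<xi>) \<delta>) (conn (quant (p b) y (subst_fm x y \<xi>)) \<delta>)"
    by (intro step_left prenex_step.here prenex_rule.Rename quant_cases assms(1))
  moreover have "prenex_step (conn (quant (p b) y (subst_fm x y \<xi>)) \<delta>)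
      (quant b y (conn (subst_fm x y \<xi>) \<delta>))"
    by (intro prenex_step.here pull_left assms(2))
  ultimately show ?thesis by (meson converse_rtranclp_into_rtranclp r_into_rtranclp)
qed

lemma rename_pull_right:
  assumes "y \<notin> vars_fm \<xi>" "y \<notin> FV \<delta>"
  shows "conn \<delta> (quant b x \<xi>) \<rhd>\<^sup>* quant b y (conn \<delta> (subst_fm x y \<xi>))"
proof -
  have "prenex_step (conn \<delta> (quant b x \<xi>)) (conn \<delta> (quant b y (subst_fm x y \<xi>)))"
    by (intro step_right prenex_step.here prenex_rule.Rename quant_cases assms(1))
  moreover have "prenex_step (conn \<delta> (quant b y (subst_fm x y \<xi>)))
      (quant b y (conn \<delta> (subst_fm x y \<xi>)))"
    by (intro prenex_step.here pull_right assms(2))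
  ultimately show ?thesis by (meson converse_rtranclp_into_rtranclp r_into_rtranclp)
qed

text \<open>Outer induction on \<open>k\<close> with \<open>b\<close> arbitrary, because the kind
  flips whenever \<open>k\<close> drops; inner induction on the total number of quantifiers, which
  decreases while \<open>k\<close> stays fixed.\<close>

lemma merge:
  assumes "prenex_within (p b) k \<phi>" "prenex_within b k \<psi>"
  shows "\<exists>\<chi>. conn \<phi> \<psi> \<rhd>\<^sup>* \<chi> \<and> prenex_within b k \<chi>"
  using assms
proof (induction k arbitrary: b \<phi> \<psi>)
  case 0
  then have "prenex_within b 0 (conn \<phi> \<psi>)" by (simp add: prenex_within_0 qfree_conn)
  then show ?case by (meson rtranclp.rtrancl_refl)
next
  case (Suc k)
  note outer_IH = Suc.IH
  from Suc.prems show ?case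
  proof (induction "quant_count \<phi> + quant_count \<psi>" arbitrary: \<phi> \<psi> rule: less_induct)
    case less
    from less.prems(1) show ?case
    proof (cases rule: prenex_within_SucE)
      case (quant x \<xi>)
      obtain y where y: "y \<notin> vars_fm \<xi>" "y \<notin> FV \<psi>" by (rule fresh_variable)
      have "\<exists>\<chi>. conn (subst_fm x y \<xi>) \<psi> \<rhd>\<^sup>* \<chi> \<and> prenex_within b (Suc k) \<chi>"
        using quant less.prems(2) by (intro less.hyps) (auto simp: prenex_within_subst_fm)
      then obtain \<chi> where \<chi>: "conn (subst_fm x y \<xi>) \<psi> \<rhd>\<^sup>* \<chi>" "prenex_within b (Suc k) \<chi>"
        by blast
      have "conn \<phi> \<psi> \<rhd>\<^sup>* quant b y (conn (subst_fm x y \<xi>) \<psi>)"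
        unfolding quant(1) using y by (rule rename_pull_left)
      also have "\<dots> \<rhd>\<^sup>* quant b y \<chi>" using \<chi>(1) by (rule prenex_steps_quant)
      finally show ?thesis using \<chi>(2) by (meson prenex_within.quant)
    next
      case swap
      note left = swap
      from less.prems(2) show ?thesis
      proof (cases rule: prenex_within_SucE)
        case (quant x \<xi>)
        obtain y where y: "y \<notin> vars_fm \<xi>" "y \<notin> FV \<phi>" by (rule fresh_variable)
        have "\<exists>\<chi>. conn \<phi> (subst_fm x y \<xi>) \<rhd>\<^sup>* \<chi> \<and> prenex_within b (Suc k) \<chi>"
          using quant less.prems(1) by (intro less.hyps) (auto simp: prenex_within_subst_fm)
        then obtain \<chi> where \<chi>: "conn \<phi> (subst_fm x y \<xi>) \<rhd>\<^sup>* \<chi>" "prenex_within b (Suc k) \<chi>"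
          by blast
        have "conn \<phi> \<psi> \<rhd>\<^sup>* quant b y (conn \<phi> (subst_fm x y \<xi>))"
          unfolding quant(1) using y by (rule rename_pull_right)
        also have "\<dots> \<rhd>\<^sup>* quant b y \<chi>" using \<chi>(1) by (rule prenex_steps_quant)
        finally show ?thesis using \<chi>(2) by (meson prenex_within.quant)
      next
        case swap
        \<comment> \<open>Neither side is taken to lead with a quantifier to pull at this level. By
          \<open>p_swap\<close> the left kind \<open>swap_sign (p b)\<close> is
          \<open>p (swap_sign b)\<close>, as the outer hypothesis requires.\<close>
        with left have "\<exists>\<chi>. conn \<phi> \<psi> \<rhd>\<^sup>* \<chi> \<and> prenex_within (swap_sign b) k \<chi>"
          by (intro outer_IH) (auto simp: p_swap)
        then show ?thesis by (meson prenex_within.swap)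
      qed
    qed
  qed
qed

lemma merge_steps:
  assumes "\<exists>\<phi>'. \<phi> \<rhd>\<^sup>* \<phi>' \<and> prenex_within (p b) k \<phi>'"
    and "\<exists>\<psi>'. \<psi> \<rhd>\<^sup>* \<psi>' \<and> prenex_within b k \<psi>'"
  shows "\<exists>\<chi>. conn \<phi> \<psi> \<rhd>\<^sup>* \<chi> \<and> prenex_within b k \<chi>"
  using assms merge steps_conn by (meson rtranclp_trans)

end

interpretation Conj: pullable_connective Conj "\<lambda>b. b"
  by unfold_locales
    (erule prenex_step.Conj_left prenex_step.Conj_right prenex_rule.Q_Conj[OF quant_cases]
      prenex_rule.Conj_Q[OF quant_cases] | simp)+

interpretation Disj: pullable_connective Disj "\<lambda>b. b"
  by unfold_locales
    (erule prenex_step.Disj_left prenex_step.Disj_right prenex_rule.Q_Disj[OF quant_cases]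
      prenex_rule.Disj_Q[OF quant_cases] | simp)+

interpretation Imp: pullable_connective Imp swap_sign
proof unfold_locales
  \<comment> \<open>Pulling out of an antecedent flips the quantifier, so each kind has its own
    rule.\<close>
  show "Imp (quant (swap_sign b) x \<xi>) \<delta> \<rhd> quant b x (Imp \<xi> \<delta>)"
    if "x \<notin> FV \<delta>" for x b and \<xi> \<delta> :: "('a, 'b) fm"
    using that by (cases b) (simp_all add: prenex_rule.Exists_Imp prenex_rule.Forall_Imp)
qed (erule prenex_step.Imp_left prenex_step.Imp_right prenex_rule.Imp_Q[OF quant_cases] | simp)+

section \<open>Alternation paths and the induction on formulas\<close>

text \<open>Path-by-path form of \<open>E_plus k\<close> (for \<open>Plus\<close>) and
  \<open>U_plus k\<close> (for \<open>Minus\<close>). The value \<open>None\<close> admits the empty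
  path at \<open>k = 0\<close>.\<close>

definition path_within :: "sign \<Rightarrow> nat \<Rightarrow> sign list \<Rightarrow> bool" where
  "path_within b k s \<longleftrightarrow> length s < k \<or> length s = k \<and> init_sign s \<in> {None, Some b}"

lemma path_within_swap: "path_within b k (map swap_sign s) \<longleftrightarrow> path_within (swap_sign b) k s"
  by (cases s; cases b; cases "hd s") (auto simp: path_within_def)

lemma length_le_deg: "s \<in> Alt \<phi> \<Longrightarrow> length s \<le> deg \<phi>"
  unfolding deg_def by (auto intro: Max_ge simp: finite_Alt)

lemma E_plus_path_within: "\<phi> \<in> E_plus k \<Longrightarrow> s \<in> Alt \<phi> \<Longrightarrow> path_within Plus k s"
  using length_le_deg[of s \<phi>]
  by (cases k) (auto simp: E_plus_def F_class_def path_within_def)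

lemma U_plus_path_within: "\<phi> \<in> U_plus k \<Longrightarrow> s \<in> Alt \<phi> \<Longrightarrow> path_within Minus k s"
  using length_le_deg[of s \<phi>]
  by (cases k) (auto simp: U_plus_def F_class_def path_within_def)

lemma Alt_quant:
  "Alt (quant b x \<phi>) = {s \<in> Alt \<phi>. init_sign s = Some b}
     \<union> {b # s | s. s \<in> Alt \<phi> \<and> init_sign s \<noteq> Some b}"
  by (cases b) auto

text \<open>A path of the body starting with \<open>b\<close> is kept; any other gains a symbol in
  front, so it was shorter than \<open>k\<close>. No path of a quantified formula is empty, hence
  \<open>k > 0\<close>.\<close>

lemma Alt_quant_path_within:
  assumes "\<forall>s \<in> Alt (quant b x \<phi>). path_within b k s"
  shows "k > 0" "\<forall>s \<in> Alt \<phi>. path_within b k s"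
proof -
  have *: "length s < k \<or> length s = k \<and> k > 0 \<and> init_sign s = Some b" if "s \<in> Alt \<phi>" for s
  proof (cases "init_sign s = Some b")
    case True
    with that assms have "path_within b k s" by (auto simp: Alt_quant)
    with True show ?thesis by (cases s) (auto simp: path_within_def)
  next
    case False
    with that assms have "path_within b k (b # s)" by (auto simp: Alt_quant)
    then show ?thesis by (auto simp: path_within_def)
  qed
  from * Alt_nonempty[of \<phi>] show "k > 0" by fastforce
  from * show "\<forall>s \<in> Alt \<phi>. path_within b k s" by (auto simp: path_within_def)
qed

text \<open>All paths start with \<open>b\<close>, so none can have the full length
  \<open>k\<close>, which would force the opposite sign. They therefore fit the bound
  \<open>k - 1\<close> for \<open>b\<close>.\<close>

lemma Alt_quant_path_within_swap:
  assumes "\<forall>s \<in> Alt (quant b x \<phi>). path_within (swap_sign b) k s"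
  obtains j where "k = Suc j" "\<forall>s \<in> Alt (quant b x \<phi>). path_within b j s"
proof -
  have init: "init_sign s = Some b" if "s \<in> Alt (quant b x \<phi>)" for s
    using that by (auto simp: Alt_quant)
  have less: "length s < k" if "s \<in> Alt (quant b x \<phi>)" for s
    using assms that init[OF that] by (cases b) (auto simp: path_within_def)
  with Alt_nonempty[of "quant b x \<phi>"] obtain j where "k = Suc j"
    by (metis all_not_in_conv less_nat_zero_code old.nat.exhaust)
  moreover from this less init have "\<forall>s \<in> Alt (quant b x \<phi>). path_within b j s"
    by (fastforce simp: path_within_def less_Suc_eq)
  ultimately show thesis by (rule that)
qed

text \<open>If the kinds agree, the quantifier extends the leading block of the transformed body.
  Otherwise the formula fits one level lower with its own kind, and \<open>swap\<close> restores the
  level.\<close>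

lemma quant_steps_prenex_within:
  assumes IH: "\<And>b k. \<forall>s \<in> Alt \<phi>. path_within b k s \<Longrightarrow> \<exists>\<psi>. \<phi> \<rhd>\<^sup>* \<psi> \<and> prenex_within b k \<psi>"
    and paths: "\<forall>s \<in> Alt (quant b x \<phi>). path_within c k s"
  shows "\<exists>\<psi>. quant b x \<phi> \<rhd>\<^sup>* \<psi> \<and> prenex_within c k \<psi>"
proof -
  have same: "\<exists>\<psi>. quant b x \<phi> \<rhd>\<^sup>* \<psi> \<and> prenex_within b j \<psi>"
    if "\<forall>s \<in> Alt (quant b x \<phi>). path_within b j s" for j
  proof -
    from Alt_quant_path_within[OF that] obtain i where
      i: "j = Suc i" "\<forall>s \<in> Alt \<phi>. path_within b j s"
      by (cases j) auto
    from IH[OF i(2)] obtain \<psi> where "\<phi> \<rhd>\<^sup>* \<psi>" "prenex_within b j \<psi>" by blast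
    then show ?thesis unfolding i(1) by (meson prenex_steps_quant prenex_within.quant)
  qed
  show ?thesis
  proof (cases "c = b")
    case True
    with same paths show ?thesis by simp
  next
    case False
    then have c: "c = swap_sign b" by (cases b; cases c) auto
    from paths[unfolded c] obtain j
      where "k = Suc j" "\<forall>s \<in> Alt (quant b x \<phi>). path_within b j s"
      by (rule Alt_quant_path_within_swap)
    with same show ?thesis
      unfolding c by (metis prenex_within.swap swap_sign_swap_sign)
  qed
qed

text \<open>Bounding single paths, rather than fixing the degree, lets the hypothesis pass to both
  arguments of a connective, whose degrees may differ.\<close>

lemma steps_prenex_within:
  assumes "\<forall>s \<in> Alt \<phi>. path_within b k s"
  shows "\<exists>\<psi>. \<phi> \<rhd>\<^sup>* \<psi> \<and> prenex_within b k \<psi>"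
  using assms
proof (induction \<phi> arbitrary: b k)
  case (Imp \<phi> \<psi>)
  show ?case
  proof (cases "qfree (Imp \<phi> \<psi>)")
    case True
    then show ?thesis by (meson prenex_within.qfree rtranclp.rtrancl_refl)
  next
    case False
    \<comment> \<open>Paths of the antecedent enter with signs swapped, so it is bounded for the
      dual kind, just what merging under an implication expects.\<close>
    with Imp.prems have "\<forall>s \<in> Alt \<phi>. path_within (swap_sign b) k s" "\<forall>s \<in> Alt \<psi>. path_within b k s"
      by (auto simp: ball_Un path_within_swap)
    then show ?thesis by (intro Imp.merge_steps Imp.IH)
  qed
next
  case (Conj \<phi> \<psi>)
  show ?case
  proof (cases "qfree (Conj \<phi> \<psi>)")
    case True
    then show ?thesis by (meson prenex_within.qfree rtranclp.rtrancl_refl)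
  next
    case False
    with Conj.prems have "\<forall>s \<in> Alt \<phi>. path_within b k s" "\<forall>s \<in> Alt \<psi>. path_within b k s"
      by auto
    then show ?thesis by (intro Conj.merge_steps Conj.IH)
  qed
next
  case (Disj \<phi> \<psi>)
  show ?case
  proof (cases "qfree (Disj \<phi> \<psi>)")
    case True
    then show ?thesis by (meson prenex_within.qfree rtranclp.rtrancl_refl)
  next
    case False
    with Disj.prems have "\<forall>s \<in> Alt \<phi>. path_within b k s" "\<forall>s \<in> Alt \<psi>. path_within b k s"
      by auto
    then show ?thesis by (intro Disj.merge_steps Disj.IH)
  qed
next
  case (Forall x \<phi>)
  then show ?case using quant_steps_prenex_within[of \<phi> Minus x b k] by simp
next
  case (Exists x \<phi>)
  then show ?case using quant_steps_prenex_within[of \<phi> Plus x b k] by simp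
qed (meson prenex_within.qfree qfree.simps rtranclp.rtrancl_refl)+

theorem theorem4p3:
  fixes L :: "('f, 'p) language" and k :: nat and \<phi> :: "('f, 'p) fm"
  assumes "\<phi> \<in> formulas L"
  shows "(\<phi> \<in> E_plus k \<longrightarrow> PNF L \<phi> \<inter> Sigma_plus k \<noteq> {}) \<and>
         (\<phi> \<in> U_plus k \<longrightarrow> PNF L \<phi> \<inter> Pi_plus k \<noteq> {})"
proof (intro conjI impI)
  assume "\<phi> \<in> E_plus k"
  then obtain \<psi> where \<psi>: "\<phi> \<rhd>\<^sup>* \<psi>" "prenex_within Plus k \<psi>"
    using steps_prenex_within E_plus_path_within by meson
  from prenex_within_Sigma_Pi_plus[OF \<psi>(2)] have cls: "\<psi> \<in> Sigma_plus k" by simp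
  then have "prenex \<psi>" by (intro Sigma_Pi_plus_prenex[of _ k]) simp
  with \<psi>(1) formulas_prenex_steps[OF \<psi>(1) assms] have "\<psi> \<in> PNF L \<phi>"
    by (simp add: PNF_def)
  with cls show "PNF L \<phi> \<inter> Sigma_plus k \<noteq> {}" by auto
next
  assume "\<phi> \<in> U_plus k"
  then obtain \<psi> where \<psi>: "\<phi> \<rhd>\<^sup>* \<psi>" "prenex_within Minus k \<psi>"
    using steps_prenex_within U_plus_path_within by meson
  from prenex_within_Sigma_Pi_plus[OF \<psi>(2)] have cls: "\<psi> \<in> Pi_plus k" by simp
  then have "prenex \<psi>" by (intro Sigma_Pi_plus_prenex[of _ k]) simp
  with \<psi>(1) formulas_prenex_steps[OF \<psi>(1) assms] have "\<psi> \<in> PNF L \<phi>"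
    by (simp add: PNF_def)
  with cls show "PNF L \<phi> \<inter> Pi_plus k \<noteq> {}" by auto
qed

end
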